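(* Let $(\Xi_n)_{n\ge 0}$ be the diminishing segment process started from $\Xi_0=[-1,1]$, let $Z_n$ be the centre of $\Xi_n$, and let $Z=\lim_{n\to\infty}Z_n$ (a limit that exists with probability $1$ and takes values in $[-1/2,1/2]$). Let $F(x)$ denote the cumulative distribution function of $Z$. Then the distribution of $Z$ is a translated arcsine law: for every $x$ with $-1/2\le x\le 1/2$, \[ F(x)=\frac{2}{\pi}\arcsin\sqrt{x+\tfrac12}. \]
   Context: The diminishing segment process is the following random sequence of closed segments of $\mathbb{R}$. Let $\Xi_0=[-1,1]$. For every $n=0,1,2,\dots$, given the first $n$ steps (i.e. given $a_1,\dots,a_n$, which determine $\Xi_0,\dots,\Xi_n$), choose a random point $a_{n+1}$ with uniform distribution on $\Xi_n$, and set \[ \Xi_{n+1}=\Xi_n\cap[a_{n+1}-1,\,a_{n+1}+1]. \] Write $\Xi_n=[Z_n-\rho_n,\,Z_n+\rho_n]$, so that $Z_n$ is the centre and $\rho_n$ is the radius of $\Xi_n$; in particular $Z_0=0$ and $\rho_0=1$. With probability $1$, $\rho_n\to 1/2$ and the sequence $(Z_n)$ converges; its limit is denoted by $Z$. *)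

theory Defs
  imports "HOL-Probability.Probability"
begin

text \<open>Points are numbered from 1, as in \<open>a\<^sub>1, a\<^sub>2, \<dots>\<close>; the value \<open>a 0\<close> is never used.\<close>

primrec segment :: "(nat \<Rightarrow> real) \<Rightarrow> nat \<Rightarrow> real set" where
  "segment a 0 = {-1..1}"
| "segment a (Suc n) = segment a n \<inter> {a (Suc n) - 1..a (Suc n) + 1}"

definition centre :: "real set \<Rightarrow> real" where
  "centre S = (Inf S + Sup S) / 2"

text \<open>The joint law of the points is prescribed through conditional probabilities:
  given the sigma-algebra generated by \<open>(a\<^sub>1, \<dots>, a\<^sub>n)\<close> (trivial for \<open>n = 0\<close>), the point
  \<open>a\<^sub>n\<^sub>+\<^sub>1\<close> is uniformly distributed on the current segment.\<close>

locale diminishing_segment_process = prob_space M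
  for M :: "'a measure" +
  fixes a :: "nat \<Rightarrow> 'a \<Rightarrow> real"
  assumes random_variable_point: "\<And>n. n \<ge> 1 \<Longrightarrow> random_variable borel (a n)"
    and uniform_point:
      "\<And>n B. B \<in> sets borel \<Longrightarrow>
        AE \<omega> in M.
          real_cond_exp M
            (vimage_algebra (space M) (\<lambda>\<omega>. \<lambda>i\<in>{1..n}. a i \<omega>) (Pi\<^sub>M {1..n} (\<lambda>_. borel)))
            (indicator (a (Suc n) -` B \<inter> space M)) \<omega>
          = measure (uniform_measure lborel (segment (\<lambda>i. a i \<omega>) n)) B"
begin

definition Xi :: "nat \<Rightarrow> 'a \<Rightarrow> real set" where
  "Xi n \<omega> = segment (\<lambda>i. a i \<omega>) n"

definition Zn :: "nat \<Rightarrow> 'a \<Rightarrow> real" where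
  "Zn n \<omega> = centre (Xi n \<omega>)"

text \<open>Where the centres do not converge, \<open>Z\<close> takes an arbitrary constant value.\<close>

definition Z :: "'a \<Rightarrow> real" where
  "Z \<omega> = lim (\<lambda>n. Zn n \<omega>)"

end

end

theory Submission
  imports Defs
begin

text \<open>
  Write \<open>\<Xi>\<^sub>n = [l, r]\<close>, so that \<open>1 \<le> r - l \<le> 2\<close>; all later centres lie in
  \<open>[l + 1/2, r - 1/2]\<close>, an interval of length \<open>g = r - l - 1\<close>. A uniform point of \<open>[l, r]\<close>
  shortens this interval from the left or from the right, in either case with probability
  \<open>g / (1 + g)\<close> and by a uniform fraction. The arcsine distribution function of that interval,
  as a function of \<open>(l, r)\<close>, is harmonic for this chain, so its expectation at time \<open>n\<close> is its
  initial value. As \<open>E g\<^sub>n\<^sub>+\<^sub>1 = E (g\<^sub>n / (1 + g\<^sub>n))\<close>, the decreasing sequence \<open>g\<^sub>n\<close> tends to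
  \<open>0\<close> almost surely; hence the harmonic function tends to the indicator of \<open>{Z \<le> x}\<close> off
  \<open>{Z = x}\<close>, and the value of the distribution function is squeezed.
\<close>

section \<open>Averaging over one uniform step\<close>

text \<open>For \<open>y\<close> in \<open>{l..r - 1}\<close> only the right end moves, to
  \<open>y + 1\<close>; in \<open>{r - 1..l + 1}\<close> nothing moves; in \<open>{l + 1..r}\<close>
  only the left end moves, to \<open>y - 1\<close>. The bounds on \<open>r - l\<close> put the
  breakpoints in this order, and a shift makes the moved end the variable of integration.\<close>

lemma has_integral_step_average:
  fixes \<Phi> :: "real \<Rightarrow> real \<Rightarrow> real"
  assumes "1 \<le> r - l" "r - l \<le> 2"
    and I: "((\<lambda>s. \<Phi> l s) has_integral I) {l + 1..r}"
    and J: "((\<lambda>s. \<Phi> s r) has_integral J) {l..r - 1}"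
  shows "((\<lambda>y. \<Phi> (max l (y - 1)) (min r (y + 1))) has_integral
           (I + (2 - (r - l)) * \<Phi> l r + J)) {l..r}"
proof -
  let ?f = "\<lambda>y. \<Phi> (max l (y - 1)) (min r (y + 1))"
  have "((\<lambda>y. \<Phi> l (y + 1)) has_integral I) {l..r - 1}"
    using has_integral_shift_real_ivl[OF I, of 1] by simp
  then have 1: "(?f has_integral I) {l..r - 1}"
  proof (rule has_integral_eq[rotated])
    fix y assume "y \<in> {l..r - 1}"
    then have "max l (y - 1) = l" "min r (y + 1) = y + 1" using assms by auto
    then show "\<Phi> l (y + 1) = ?f y" by simp
  qed
  have "((\<lambda>y. \<Phi> l r) has_integral (2 - (r - l)) * \<Phi> l r) {r - 1..l + 1}"
    using has_integral_const_real[of "\<Phi> l r" "r - 1" "l + 1"] assms by (simp add: algebra_simps)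
  then have 2: "(?f has_integral (2 - (r - l)) * \<Phi> l r) {r - 1..l + 1}"
  proof (rule has_integral_eq[rotated])
    fix y assume "y \<in> {r - 1..l + 1}"
    then have "max l (y - 1) = l" "min r (y + 1) = r" using assms by auto
    then show "\<Phi> l r = ?f y" by simp
  qed
  have "((\<lambda>y. \<Phi> (y - 1) r) has_integral J) {l + 1..r}"
    using has_integral_shift_real_ivl[OF J, of "-1"] by simp
  then have 3: "(?f has_integral J) {l + 1..r}"
  proof (rule has_integral_eq[rotated])
    fix y assume "y \<in> {l + 1..r}"
    then have "max l (y - 1) = y - 1" "min r (y + 1) = r" using assms by auto
    then show "\<Phi> (y - 1) r = ?f y" by simp
  qed
  have "(?f has_integral I + (2 - (r - l)) * \<Phi> l r) {l..l + 1}"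
    by (rule has_integral_combine[OF _ _ 1 2]) (use assms in auto)
  from has_integral_combine[OF _ _ this 3] assms show ?thesis by auto
qed

section \<open>Integrals of the arcsine function\<close>

text \<open>Antiderivative in \<open>d\<close> of \<open>2 / pi * arcsin (sqrt (c / d))\<close>,
  obtained by parts; its value at \<open>d = c\<close> is \<open>c\<close>.\<close>

definition arcsine_primitive :: "real \<Rightarrow> real \<Rightarrow> real" where
  "arcsine_primitive c d = 2 / pi * (d * arcsin (sqrt (c / d)) + sqrt (c * (d - c)))"

lemma has_integral_arcsin_sqrt_divide:
  fixes c d :: real
  assumes "0 < c" "c \<le> d"
  shows "((\<lambda>s. 2 / pi * arcsin (sqrt (c / s))) has_integral (arcsine_primitive c d - c)) {c..d}"
proof -
  have "((\<lambda>s. 2 / pi * arcsin (sqrt (c / s))) has_integral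
      (arcsine_primitive c d - arcsine_primitive c c)) {c..d}"
  \<comment> \<open>Both summands of the primitive have infinite slope at \<open>s = c\<close>, so
    they are differentiated only in the interior.\<close>
  proof (rule fundamental_theorem_of_calculus_interior)
    show "c \<le> d" by fact
    show "continuous_on {c..d} (arcsine_primitive c)"
      unfolding arcsine_primitive_def using assms
      by (intro continuous_intros)
         (auto intro: order.trans[of _ 0] simp: divide_simps)
    fix s assume s: "s \<in> {c<..<d}"
    then have s0: "0 < s" "c < s" using assms by auto
    let ?u = "sqrt c" and ?v = "sqrt s" and ?w = "sqrt (s - c)"
    have pos: "?u > 0" "?v > 0" "?w > 0" using s0 assms by auto
    have "((\<lambda>s. sqrt (c / s)) has_real_derivative
             (- (?u / (2 * s * ?v)))) (at s)"
      using s0 assms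
      by (auto intro!: derivative_eq_intros simp: real_sqrt_divide field_simps power2_eq_square)
    moreover have "-1 < sqrt (c / s)" "sqrt (c / s) < 1"
      using s0 assms by (auto intro: less_le_trans[of _ 0])
    ultimately have "((\<lambda>s. arcsin (sqrt (c / s))) has_real_derivative
        (inverse (sqrt (1 - (sqrt (c / s))\<^sup>2)) * (- (?u / (2 * s * ?v))))) (at s)"
      by (intro DERIV_chain2[OF DERIV_arcsin])
    moreover have "sqrt (1 - (sqrt (c / s))\<^sup>2) = ?w / ?v"
    proof -
      have "1 - (sqrt (c / s))\<^sup>2 = (s - c) / s" using s0 assms by (simp add: field_simps)
      then show ?thesis by (simp add: real_sqrt_divide)
    qed
    ultimately have 1: "((\<lambda>s. arcsin (sqrt (c / s))) has_real_derivative - (?u / (2 * s * ?w))) (at s)"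
      using pos by (simp add: mult.commute)
    have 2: "((\<lambda>s. sqrt (c * (s - c))) has_real_derivative (?u / (2 * ?w))) (at s)"
    proof -
      have "((\<lambda>s. ?u * sqrt (s - c)) has_real_derivative (?u / (2 * ?w))) (at s)"
        using s0 by (auto intro!: derivative_eq_intros simp: field_simps)
      then show ?thesis by (simp add: real_sqrt_mult)
    qed
    have "((arcsine_primitive c) has_real_derivative
        2 / pi * (1 * arcsin (sqrt (c / s)) + - (?u / (2 * s * ?w)) * s + ?u / (2 * ?w))) (at s)"
      unfolding arcsine_primitive_def
      by (intro DERIV_cmult DERIV_add DERIV_mult DERIV_ident 1 2)
    moreover have "1 * arcsin (sqrt (c / s)) + - (?u / (2 * s * ?w)) * s + ?u / (2 * ?w) = arcsin (sqrt (c / s))"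
      using s0 by simp
    ultimately show "((arcsine_primitive c) has_vector_derivative 2 / pi * arcsin (sqrt (c / s))) (at s)"
      by (simp add: has_real_derivative_iff_has_vector_derivative)
  qed
  moreover have "arcsine_primitive c c = c" using assms by (simp add: arcsine_primitive_def)
  ultimately show ?thesis by simp
qed

text \<open>The symmetry of the arcsine law about its midpoint, which carries the integral for a
  moving right end over to a moving left end.\<close>

lemma arcsin_sqrt_complement:
  fixes t :: real
  assumes "0 \<le> t" "t \<le> 1"
  shows "arcsin (sqrt (1 - t)) = pi / 2 - arcsin (sqrt t)"
proof -
  have "arccos (sqrt t) = arcsin (sqrt (1 - (sqrt t)\<^sup>2))"
    by (rule arccos_arcsin_sqrt_pos) (use assms in auto)
  moreover have "arccos (sqrt t) = pi / 2 - arcsin (sqrt t)"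
    by (rule arccos_arcsin_eq) (use assms in \<open>auto intro: order.trans[of _ 0]\<close>)
  ultimately show ?thesis using assms by simp
qed

section \<open>The harmonic function and the mean gap\<close>

text \<open>The order of the tests matters: at \<open>r - l = 1\<close> the first one yields the
  distribution function of a point mass, with value \<open>1\<close> at the atom, and the quotient
  is evaluated only where \<open>r - l > 1\<close>.\<close>

definition limit_cdf :: "real \<Rightarrow> real \<Rightarrow> real \<Rightarrow> real" where
  "limit_cdf x l r = (if r - 1/2 \<le> x then 1 else if x \<le> l + 1/2 then 0
     else 2 / pi * arcsin (sqrt ((x - l - 1/2) / (r - l - 1))))"

lemma limit_cdf_bounds: "0 \<le> limit_cdf x l r" "limit_cdf x l r \<le> 1"
proof -
  have "0 \<le> arcsin (sqrt t) \<and> arcsin (sqrt t) \<le> pi / 2" if "0 \<le> t" "t \<le> 1" for t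
    using that arcsin_le_arcsin[of 0 "sqrt t"] arcsin_ubound[of "sqrt t"]
      order.trans[of "-1" 0 "sqrt t"] by simp
  from this[of "(x - l - 1/2) / (r - l - 1)"]
  show "0 \<le> limit_cdf x l r" "limit_cdf x l r \<le> 1"
    by (auto simp: limit_cdf_def field_simps)
qed

lemma measurable_limit_cdf [measurable (raw)]:
  assumes [measurable]: "f \<in> borel_measurable N" "g \<in> borel_measurable N"
  shows "(\<lambda>\<omega>. limit_cdf x (f \<omega>) (g \<omega>)) \<in> borel_measurable N"
proof -
  \<comment> \<open>Clamping the argument gives a function continuous on the whole line. It changes
    nothing, since the quotient lies in the unit interval in the only branch that uses it.\<close>
  define h :: "real \<Rightarrow> real" where "h t = arcsin (max 0 (min 1 t))" for t
  have "continuous_on UNIV h"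
    unfolding h_def by (intro continuous_intros) (auto simp: min_def max_def)
  then have [measurable]: "h \<in> borel_measurable borel"
    by (rule borel_measurable_continuous_onI)
  have "limit_cdf x l r = (if r - 1/2 \<le> x then 1 else if x \<le> l + 1/2 then 0
      else 2 / pi * h (sqrt ((x - l - 1/2) / (r - l - 1))))" for l r
    by (auto simp: limit_cdf_def h_def max_def min_def divide_simps)
  then show ?thesis by simp
qed

text \<open>The factor \<open>r - l\<close> is the length of the segment: dividing by it gives the
  mean over a uniform point. If \<open>x\<close> lies outside the open interval of possible limits,
  the integrand is constant up to one point; otherwise each moving end contributes an arcsine
  integral.\<close>

lemma limit_cdf_harmonic:
  assumes lr: "1 \<le> r - l" "r - l \<le> 2"
  shows "((\<lambda>y. limit_cdf x (max l (y - 1)) (min r (y + 1))) has_integral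
           (r - l) * limit_cdf x l r) {l..r}"
proof -
  consider "r - 1/2 \<le> x" | "x \<le> l + 1/2" "x < r - 1/2" | "l + 1/2 < x" "x < r - 1/2"
    by linarith
  then show ?thesis
  proof cases
    case 1
    then have "limit_cdf x (max l (y - 1)) (min r (y + 1)) = 1" for y
      by (auto simp: limit_cdf_def)
    with 1 show ?thesis using has_integral_const_real[of "1::real" l r] lr
      by (simp add: limit_cdf_def)
  next
    case 2
    \<comment> \<open>A nonzero value requires \<open>y + 1 \<le> x + 1/2\<close>, which within
      \<open>{l..r}\<close> forces \<open>y = x - 1/2 = l\<close>.\<close>
    show ?thesis
      by (rule has_integral_spike_finite[of "{x - 1/2}" _ _ "\<lambda>_. 0"])
         (use 2 in \<open>auto simp: limit_cdf_def min_def max_def split: if_splits\<close>)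
  next
    case 3
    \<comment> \<open>\<open>d\<close> is the length of the interval of possible limits,
      \<open>c\<close> the distance of \<open>x\<close> from its left end.\<close>
    define c d where "c = x - l - 1/2" and "d = r - l - 1"
    have cd: "0 < c" "c < d" using 3 by (auto simp: c_def d_def)
    \<comment> \<open>Moving the right end to \<open>s\<close> keeps \<open>c\<close> and turns
      \<open>d\<close> into \<open>s - l - 1\<close>; up to \<open>s = x + 1/2\<close> the value is
      \<open>1\<close>.\<close>
    have "((\<lambda>s. limit_cdf x l s) has_integral c + (arcsine_primitive c d - c)) {l + 1..r}"
    proof (rule has_integral_combine)
      show "l + 1 \<le> x + 1/2" "x + 1/2 \<le> r" using 3 by auto
      have "((\<lambda>s::real. 1) has_integral c) {l + 1..x + 1/2}"
        using has_integral_const_real[of "1::real" "l + 1" "x + 1/2"] 3 by (simp add: c_def)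
      then show "((\<lambda>s. limit_cdf x l s) has_integral c) {l + 1..x + 1/2}"
        by (rule has_integral_eq[rotated]) (auto simp: limit_cdf_def)
      have "((\<lambda>s. 2 / pi * arcsin (sqrt (c / (s - (l + 1))))) has_integral (arcsine_primitive c d - c)) {x + 1/2..r}"
        using has_integral_shift_real_ivl[OF has_integral_arcsin_sqrt_divide[of c d], of "-(l + 1)"] cd
        by (simp add: c_def d_def algebra_simps)
      then show "((\<lambda>s. limit_cdf x l s) has_integral (arcsine_primitive c d - c)) {x + 1/2..r}"
        by (rule has_integral_spike_finite[of "{x + 1/2}", rotated 2])
           (use 3 in \<open>auto simp: limit_cdf_def c_def algebra_simps\<close>)
    qed
    then have I: "((\<lambda>s. limit_cdf x l s) has_integral arcsine_primitive c d) {l + 1..r}" by simp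
    \<comment> \<open>Moving the left end changes numerator and denominator together, but
      \<open>1 - (x - s - 1/2) / (r - s - 1)\<close> has the constant numerator
      \<open>d - c\<close>. So the complement, a reflection and a shift lead back to the known
      integral. From \<open>s = x - 1/2\<close> on the value is \<open>0\<close>.\<close>
    have "((\<lambda>s. limit_cdf x s r) has_integral (c - (arcsine_primitive (d - c) d - (d - c))) + 0) {l..r - 1}"
    proof (rule has_integral_combine)
      show "l \<le> x - 1/2" "x - 1/2 \<le> r - 1" using 3 by auto
      have "((\<lambda>s. 2 / pi * arcsin (sqrt ((d - c) / s))) has_integral (arcsine_primitive (d - c) d - (d - c))) {d - c..d}"
        by (rule has_integral_arcsin_sqrt_divide) (use cd in auto)
      then have "((\<lambda>s. 2 / pi * arcsin (sqrt ((d - c) / - s))) has_integral (arcsine_primitive (d - c) d - (d - c))) {- d..- (d - c)}"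
        by (subst (asm) has_integral_reflect_real[symmetric])
      from has_integral_shift_real_ivl[OF this, of "-(r - 1)"]
      have "((\<lambda>s. 2 / pi * arcsin (sqrt ((d - c) / (r - 1 - s)))) has_integral (arcsine_primitive (d - c) d - (d - c))) {l..x - 1/2}"
        by (simp add: c_def d_def algebra_simps)
      moreover have "((\<lambda>s::real. 1) has_integral c) {l..x - 1/2}"
        using has_integral_const_real[of "1::real" l "x - 1/2"] 3 by (simp add: c_def algebra_simps)
      ultimately have "((\<lambda>s. 1 - 2 / pi * arcsin (sqrt ((d - c) / (r - 1 - s)))) has_integral
          (c - (arcsine_primitive (d - c) d - (d - c)))) {l..x - 1/2}"
        by (intro has_integral_diff)
      then show "((\<lambda>s. limit_cdf x s r) has_integral (c - (arcsine_primitive (d - c) d - (d - c)))) {l..x - 1/2}"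
      proof (rule has_integral_spike_finite[of "{x - 1/2}", rotated 2])
        fix s assume s: "s \<in> {l..x - 1/2} - {x - 1/2}"
        let ?t = "(d - c) / (r - 1 - s)"
        have e: "1 - ?t = (x - s - 1/2) / (r - s - 1)"
          using s 3 by (simp add: c_def d_def divide_simps) (simp add: algebra_simps)
        have "arcsin (sqrt (1 - ?t)) = pi / 2 - arcsin (sqrt ?t)"
          by (rule arcsin_sqrt_complement) (use s 3 in \<open>auto simp: c_def d_def divide_simps\<close>)
        then have "2 / pi * arcsin (sqrt (1 - ?t)) = 1 - 2 / pi * arcsin (sqrt ?t)"
          by (simp add: field_simps)
        then show "limit_cdf x s r = 1 - 2 / pi * arcsin (sqrt ?t)"
          using s 3 unfolding e by (auto simp: limit_cdf_def)
      qed auto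
      show "((\<lambda>s. limit_cdf x s r) has_integral 0) {x - 1/2..r - 1}"
        by (rule has_integral_is_0) (use 3 in \<open>auto simp: limit_cdf_def\<close>)
    qed
    then have J: "((\<lambda>s. limit_cdf x s r) has_integral d - arcsine_primitive (d - c) d) {l..r - 1}"
      by simp
    have "arcsin (sqrt ((d - c) / d)) = pi / 2 - arcsin (sqrt (c / d))"
      using arcsin_sqrt_complement[of "c / d"] cd by (simp add: field_simps)
    \<comment> \<open>The root \<open>sqrt (c * (d - c))\<close> is symmetric in \<open>c\<close>
      and \<open>d - c\<close>, so it cancels from the sum of the two end contributions, leaving
      \<open>2 * d\<close> times the value at \<open>(l, r)\<close>. The middle piece adds
      \<open>1 - d\<close> times it, and \<open>1 + d = r - l\<close>.\<close>
    then have "arcsine_primitive (d - c) d = d - arcsine_primitive c d + 4 / pi * sqrt (c * (d - c))"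
      by (simp add: arcsine_primitive_def mult.commute[of "d - c"]) (simp add: field_simps)
    moreover have "limit_cdf x l r = 2 / pi * arcsin (sqrt (c / d))"
      using 3 by (simp add: limit_cdf_def c_def d_def)
    ultimately have "arcsine_primitive c d + (2 - (r - l)) * limit_cdf x l r + (d - arcsine_primitive (d - c) d)
        = (r - l) * limit_cdf x l r"
      by (simp add: arcsine_primitive_def) (simp add: d_def field_simps)
    with has_integral_step_average[OF lr I J] show ?thesis by simp
  qed
qed

text \<open>With \<open>g = r - l - 1\<close> each moving end contributes
  \<open>g\<^sup>2 / 2\<close> and the unchanged piece \<open>(1 - g) * g\<close>. Division by the
  length \<open>1 + g\<close> gives the mean new gap \<open>g / (1 + g)\<close>.\<close>

lemma gap_average:
  fixes l r :: real
  assumes lr: "1 \<le> r - l" "r - l \<le> 2"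
  shows "((\<lambda>y. min r (y + 1) - max l (y - 1) - 1) has_integral (r - l - 1)) {l..r}"
proof -
  let ?g = "r - l - 1"
  have D: "((\<lambda>s. (s - l - 1)\<^sup>2 / 2) has_vector_derivative s - l - 1) (at s within S)"
    "((\<lambda>s. - ((r - s - 1)\<^sup>2 / 2)) has_vector_derivative r - s - 1) (at s within S)" for s S
    unfolding has_real_derivative_iff_has_vector_derivative[symmetric]
    by (auto intro!: derivative_eq_intros simp: field_simps)
  have I: "((\<lambda>s. s - l - 1) has_integral (?g\<^sup>2 / 2 - 0)) {l + 1..r}"
    using fundamental_theorem_of_calculus[OF _ D(1), of "l + 1" r] lr by simp
  have J: "((\<lambda>s. r - s - 1) has_integral (0 - - (?g\<^sup>2 / 2))) {l..r - 1}"
    using fundamental_theorem_of_calculus[OF _ D(2), of l "r - 1"] lr by simp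
  have e: "?g\<^sup>2 / 2 - 0 + (2 - (r - l)) * ?g + (0 - - (?g\<^sup>2 / 2)) = ?g"
    by (simp add: power2_eq_square algebra_simps)
  show ?thesis
    using has_integral_step_average[OF lr, of "\<lambda>l r. r - l - 1", OF I J] unfolding e .
qed

section \<open>Endpoints as real recursions, and the uniform density\<close>

primrec left_end :: "(nat \<Rightarrow> real) \<Rightarrow> nat \<Rightarrow> real" where
  "left_end a 0 = -1"
| "left_end a (Suc n) = max (left_end a n) (a (Suc n) - 1)"

primrec right_end :: "(nat \<Rightarrow> real) \<Rightarrow> nat \<Rightarrow> real" where
  "right_end a 0 = 1"
| "right_end a (Suc n) = min (right_end a n) (a (Suc n) + 1)"

text \<open>Also covers empty segments, where the left end exceeds the right one; segments can
  therefore be rewritten at every sample point.\<close>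

lemma segment_eq: "segment a n = {left_end a n..right_end a n}"
  by (induction n) auto

lemma left_end_incseq: "incseq (left_end a)"
  by (rule incseq_SucI) simp

lemma right_end_decseq: "decseq (right_end a)"
  by (rule decseq_SucI) simp

lemma right_end_le: "right_end a n \<le> 1"
  using decseqD[OF right_end_decseq, of 0 n a] by simp

text \<open>Kept general in \<open>N\<close>, and restricted to the first \<open>n\<close> points,
  to serve both \<open>M\<close> and the sigma-algebra of the past.\<close>

lemma measurable_left_end:
  assumes "\<And>i. i \<in> {1..n} \<Longrightarrow> a i \<in> borel_measurable N"
  shows "(\<lambda>\<omega>. left_end (\<lambda>i. a i \<omega>) n) \<in> borel_measurable N"
  using assms by (induction n) auto

lemma measurable_right_end:
  assumes "\<And>i. i \<in> {1..n} \<Longrightarrow> a i \<in> borel_measurable N"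
  shows "(\<lambda>\<omega>. right_end (\<lambda>i. a i \<omega>) n) \<in> borel_measurable N"
  using assms by (induction n) auto

text \<open>For \<open>l \<ge> r\<close> the kernel vanishes almost everywhere, which matches \<^const>\<open>uniform_measure\<close>
  on a null set: there it is the zero measure.\<close>

definition uniform_kernel :: "(real \<times> real) \<times> real \<Rightarrow> ennreal" where
  "uniform_kernel p = (if fst (fst p) \<le> snd p \<and> snd p \<le> snd (fst p)
     then 1 / ennreal (snd (fst p) - fst (fst p)) else 0)"

lemma measurable_uniform_kernel [measurable]:
  "uniform_kernel \<in> borel_measurable ((borel \<Otimes>\<^sub>M borel) \<Otimes>\<^sub>M borel)"
  unfolding uniform_kernel_def[abs_def] by measurable

text \<open>Expresses the uniform law by a density jointly measurable in the two ends and the point,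
  as Tonelli's theorem requires later.\<close>

lemma emeasure_uniform_interval:
  fixes l r :: real
  assumes [measurable]: "B \<in> sets borel"
  shows "ennreal (measure (uniform_measure lborel {l..r}) B) =
    (\<integral>\<^sup>+y. uniform_kernel ((l, r), y) * indicator B y \<partial>lborel)"
proof -
  let ?U = "uniform_measure lborel {l..r}"
  have "emeasure ?U B = (\<integral>\<^sup>+y. uniform_kernel ((l, r), y) * indicator B y \<partial>lborel)"
    unfolding uniform_measure_def
    by (subst emeasure_density)
       (auto intro!: nn_integral_cong simp: uniform_kernel_def split: split_indicator)
  \<comment> \<open>\<open>measure\<close> sends an infinite value to \<open>0\<close>, so
    finiteness must be settled first; for a null interval the mass is \<open>0 / 0 = 0\<close> in
    \<open>ennreal\<close>.\<close>
  moreover have "emeasure ?U B \<noteq> \<top>"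
  proof (cases "l < r")
    case True
    then interpret U: prob_space ?U by (intro prob_space_uniform_measure) auto
    show ?thesis using U.emeasure_finite[of B] .
  next
    case False
    have "emeasure ?U B \<le> emeasure ?U UNIV" by (rule emeasure_mono) auto
    also have "\<dots> = 0" using False by (auto simp: emeasure_lborel_Icc_eq)
    finally show ?thesis by (simp del: emeasure_uniform_measure)
  qed
  ultimately show ?thesis by (simp del: emeasure_uniform_measure add: emeasure_eq_ennreal_measure)
qed

section \<open>Law of the next point given the endpoints\<close>

context diminishing_segment_process
begin

abbreviation L :: "nat \<Rightarrow> 'a \<Rightarrow> real" where "L n \<omega> \<equiv> left_end (\<lambda>i. a i \<omega>) n"
abbreviation R :: "nat \<Rightarrow> 'a \<Rightarrow> real" where "R n \<omega> \<equiv> right_end (\<lambda>i. a i \<omega>) n"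

abbreviation past :: "nat \<Rightarrow> 'a measure" where
  "past n \<equiv> vimage_algebra (space M) (\<lambda>\<omega>. \<lambda>i\<in>{1..n}. a i \<omega>) (Pi\<^sub>M {1..n} (\<lambda>_. borel))"

lemma measurable_a_Suc [measurable]: "a (Suc n) \<in> borel_measurable M"
  by (rule random_variable_point) simp

lemma measurable_ends [measurable]:
  "L n \<in> borel_measurable M" "R n \<in> borel_measurable M"
  by (auto intro!: measurable_left_end measurable_right_end random_variable_point)

lemma subalgebra_past: "subalgebra M (past n)"
proof -
  have "(\<lambda>\<omega>. \<lambda>i\<in>{1..n}. a i \<omega>) \<in> M \<rightarrow>\<^sub>M Pi\<^sub>M {1..n} (\<lambda>_. borel)"
    by (rule measurable_restrict) (auto intro: random_variable_point)
  then show ?thesis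
    unfolding subalgebra_def
    by (auto simp: sets_vimage_algebra2 space_PiM)
qed

lemma measurable_point_past:
  assumes "i \<in> {1..n}"
  shows "a i \<in> borel_measurable (past n)"
proof -
  have "(\<lambda>\<omega>. (\<lambda>i\<in>{1..n}. a i \<omega>) i) \<in> borel_measurable (past n)"
    by (rule measurable_compose[OF measurable_vimage_algebra1 measurable_component_singleton])
       (use assms in \<open>auto simp: space_PiM\<close>)
  then show ?thesis using assms by simp
qed

lemma measurable_ends_past:
  "L n \<in> borel_measurable (past n)" "R n \<in> borel_measurable (past n)"
  by (rule measurable_left_end measurable_right_end, erule measurable_point_past)+

text \<open>The event that the ends lie in \<open>C\<close> belongs to \<open>past n\<close>, so the
  prescribed conditional probability may be integrated over it.\<close>

lemma emeasure_next_point: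
  assumes C: "C \<in> sets (borel \<Otimes>\<^sub>M borel)" and B [measurable]: "B \<in> sets borel"
  shows "emeasure M {\<omega> \<in> space M. (L n \<omega>, R n \<omega>) \<in> C \<and> a (Suc n) \<omega> \<in> B} =
    (\<integral>\<^sup>+\<omega>. (\<integral>\<^sup>+y. uniform_kernel ((L n \<omega>, R n \<omega>), y) * indicator B y \<partial>lborel) *
       indicator C (L n \<omega>, R n \<omega>) \<partial>M)"
proof -
  interpret past: finite_measure_subalgebra M "past n"
    by (intro finite_measure_subalgebra.intro finite_measure_subalgebra_axioms.intro subalgebra_past)
       unfold_locales
  let ?A = "(\<lambda>\<omega>. (L n \<omega>, R n \<omega>)) -` C \<inter> space M"
  let ?E = "a (Suc n) -` B \<inter> space M"
  let ?u = "\<lambda>\<omega>. measure (uniform_measure lborel {L n \<omega>..R n \<omega>}) B"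
  have set_eq: "?A \<inter> ?E = {\<omega> \<in> space M. (L n \<omega>, R n \<omega>) \<in> C \<and> a (Suc n) \<omega> \<in> B}" by auto
  have [measurable]: "C \<in> sets (borel \<Otimes>\<^sub>M borel)" by (rule C)
  have "(\<lambda>\<omega>. (L n \<omega>, R n \<omega>)) \<in> past n \<rightarrow>\<^sub>M borel \<Otimes>\<^sub>M borel"
    by (intro measurable_Pair measurable_ends_past)
  from measurable_sets[OF this C] have A: "?A \<in> sets (past n)" by simp
  then have [measurable]: "?A \<in> sets M"
    using subalgebra_past[of n] by (auto simp: subalgebra_def)
  have [measurable]: "?E \<in> sets M" by measurable
  have u_eq: "ennreal (?u \<omega>) = (\<integral>\<^sup>+y. uniform_kernel ((L n \<omega>, R n \<omega>), y) * indicator B y \<partial>lborel)" for \<omega>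
    by (rule emeasure_uniform_interval) fact
  have "(\<lambda>\<omega>. enn2real (\<integral>\<^sup>+y. uniform_kernel ((L n \<omega>, R n \<omega>), y) * indicator B y \<partial>lborel)) \<in> borel_measurable M"
    by measurable
  then have [measurable]: "?u \<in> borel_measurable M"
    unfolding u_eq[symmetric] by simp
  \<comment> \<open>Degenerate segments must be covered here, because the almost sure bound on the
    length is itself deduced from this lemma. For them the kernel vanishes off a single
    point.\<close>
  have bound: "?u \<omega> \<le> 1" for \<omega>
  proof (cases "L n \<omega> < R n \<omega>")
    case True
    then interpret U: prob_space "uniform_measure lborel {L n \<omega>..R n \<omega>}"
      by (intro prob_space_uniform_measure) auto
    show ?thesis by simp
  next
    case False
    then have "uniform_kernel ((L n \<omega>, R n \<omega>), y) = 0 \<or> y = L n \<omega>" for y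
      by (auto simp: uniform_kernel_def)
    then have "AE y in lborel. uniform_kernel ((L n \<omega>, R n \<omega>), y) * indicator B y = 0"
      using AE_lborel_singleton[of "L n \<omega>"] by (auto elim!: eventually_mono)
    then have "ennreal (?u \<omega>) = 0" unfolding u_eq by (subst nn_integral_0_iff_AE) auto
    then show ?thesis by simp
  qed
  have "measure M (?A \<inter> ?E) = (\<integral>\<omega>. indicator (?A \<inter> ?E) \<omega> \<partial>M)"
    using \<open>?A \<in> sets M\<close> \<open>?E \<in> sets M\<close> by (subst Bochner_Integration.integral_indicator) (simp_all add: Int_absorb2)
  also have "\<dots> = (LINT \<omega>:?A|M. indicator ?E \<omega>)"
    unfolding set_lebesgue_integral_def
    by (rule Bochner_Integration.integral_cong) (simp_all add: indicator_inter_arith)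
  also have "\<dots> = (LINT \<omega>:?A|M. real_cond_exp M (past n) (indicator ?E) \<omega>)"
    by (rule past.real_cond_exp_intA[OF _ A])
       (use \<open>?E \<in> sets M\<close> in \<open>simp add: integrable_indicator_iff emeasure_eq_measure\<close>)
  also have "\<dots> = (LINT \<omega>:?A|M. ?u \<omega>)"
    unfolding set_lebesgue_integral_def
  proof (rule integral_cong_AE)
    have "AE \<omega> in M. real_cond_exp M (past n) (indicator ?E) \<omega> = ?u \<omega>"
      using uniform_point[OF B, of n] by (simp only: segment_eq)
    then show "AE \<omega> in M. indicat_real ?A \<omega> *\<^sub>R real_cond_exp M (past n) (indicator ?E) \<omega> = indicat_real ?A \<omega> *\<^sub>R ?u \<omega>"
      by (rule eventually_mono) (simp only:)
  qed measurable
  finally have "emeasure M (?A \<inter> ?E) = ennreal (\<integral>\<omega>. indicator ?A \<omega> * ?u \<omega> \<partial>M)"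
    by (simp only: emeasure_eq_measure set_lebesgue_integral_def real_scaleR_def)
  also have "\<dots> = (\<integral>\<^sup>+\<omega>. ennreal (indicator ?A \<omega> * ?u \<omega>) \<partial>M)"
  proof (rule nn_integral_eq_integral[symmetric])
    have "norm (indicator ?A \<omega> * ?u \<omega>) \<le> 1" for \<omega>
      using bound[of \<omega>] by (cases "\<omega> \<in> ?A") (simp_all only: indicator_simps, simp_all)
    then show "integrable M (\<lambda>\<omega>. indicator ?A \<omega> * ?u \<omega>)"
      by (intro integrable_const_bound[where B = 1] AE_I2) measurable
  qed (simp add: zero_le_mult_iff)
  also have "\<dots> = (\<integral>\<^sup>+\<omega>. ennreal (?u \<omega>) * indicator C (L n \<omega>, R n \<omega>) \<partial>M)"
  proof (rule nn_integral_cong)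
    fix \<omega> assume "\<omega> \<in> space M"
    then show "ennreal (indicator ?A \<omega> * ?u \<omega>) = ennreal (?u \<omega>) * indicator C (L n \<omega>, R n \<omega>)"
      by (cases "(L n \<omega>, R n \<omega>) \<in> C") (simp_all del: measure_uniform_measure)
  qed
  finally show ?thesis
    by (simp only: u_eq set_eq)
qed

text \<open>Both measures agree on products \<open>C \<times> B\<close>, an intersection-stable
  generator of the sigma-algebra; \<open>UNIV\<close> is such a product and has finite mass, so they
  coincide.\<close>

lemma distr_next_point:
  "distr M ((borel \<Otimes>\<^sub>M borel) \<Otimes>\<^sub>M borel) (\<lambda>\<omega>. ((L n \<omega>, R n \<omega>), a (Suc n) \<omega>)) =
   density (distr M (borel \<Otimes>\<^sub>M borel) (\<lambda>\<omega>. (L n \<omega>, R n \<omega>)) \<Otimes>\<^sub>M lborel) uniform_kernel"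
proof -
  define S where "S = distr M (borel \<Otimes>\<^sub>M borel) (\<lambda>\<omega>. (L n \<omega>, R n \<omega>))"
  define D where "D = distr M ((borel \<Otimes>\<^sub>M borel) \<Otimes>\<^sub>M borel) (\<lambda>\<omega>. ((L n \<omega>, R n \<omega>), a (Suc n) \<omega>))"
  define E where "E = {C \<times> B |C B. C \<in> sets (borel \<Otimes>\<^sub>M borel :: (real \<times> real) measure) \<and> B \<in> sets (borel :: real measure)}"
  have [measurable_cong, simp]: "sets S = sets (borel \<Otimes>\<^sub>M borel)" by (simp add: S_def)
  have sigma_E: "sets ((borel \<Otimes>\<^sub>M borel) \<Otimes>\<^sub>M borel :: ((real \<times> real) \<times> real) measure) = sigma_sets UNIV E"
    unfolding E_def by (subst sets_pair_measure) (simp add: space_pair_measure)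
  have "D = density (S \<Otimes>\<^sub>M lborel) uniform_kernel"
  proof (rule measure_eqI_generator_eq[where E = E and \<Omega> = UNIV and A = "\<lambda>_. UNIV"])
    show "Int_stable E" unfolding E_def by (rule Int_stable_pair_measure_generator)
    show "sets D = sigma_sets UNIV E" by (simp add: D_def sigma_E)
    have "sets (S \<Otimes>\<^sub>M lborel) = sets ((borel \<Otimes>\<^sub>M borel) \<Otimes>\<^sub>M borel :: ((real \<times> real) \<times> real) measure)"
      by (intro sets_pair_measure_cong) simp_all
    then show "sets (density (S \<Otimes>\<^sub>M lborel) uniform_kernel) = sigma_sets UNIV E"
      by (simp add: sigma_E)
    interpret D: prob_space D unfolding D_def by (rule prob_space_distr) measurable
    show "emeasure D UNIV \<noteq> \<infinity>" by simp
    have "UNIV \<in> sets (borel \<Otimes>\<^sub>M borel :: (real \<times> real) measure)"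
      using sets.top[of "borel \<Otimes>\<^sub>M borel :: (real \<times> real) measure"] by (simp add: space_pair_measure)
    then show "range (\<lambda>_::nat. UNIV) \<subseteq> E"
      unfolding E_def by (auto intro!: exI[of _ UNIV])
    fix X assume "X \<in> E"
    then obtain C B where X: "X = C \<times> B"
      and C [measurable]: "C \<in> sets (borel \<Otimes>\<^sub>M borel)" and B [measurable]: "B \<in> sets borel"
      unfolding E_def by blast
    have [measurable]: "X \<in> sets ((borel \<Otimes>\<^sub>M borel) \<Otimes>\<^sub>M borel)" unfolding X by measurable
    have "(\<lambda>\<omega>. ((L n \<omega>, R n \<omega>), a (Suc n) \<omega>)) -` X \<inter> space M =
        {\<omega> \<in> space M. (L n \<omega>, R n \<omega>) \<in> C \<and> a (Suc n) \<omega> \<in> B}"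
      by (auto simp: X)
    then have "emeasure D X = emeasure M {\<omega> \<in> space M. (L n \<omega>, R n \<omega>) \<in> C \<and> a (Suc n) \<omega> \<in> B}"
      unfolding D_def by (subst emeasure_distr) simp_all
    also have "\<dots> = (\<integral>\<^sup>+s. (\<integral>\<^sup>+y. uniform_kernel (s, y) * indicator B y \<partial>lborel) * indicator C s \<partial>S)"
      unfolding emeasure_next_point[OF C B] S_def by (rule nn_integral_distr[symmetric]) measurable
    also have "\<dots> = (\<integral>\<^sup>+s. (\<integral>\<^sup>+y. uniform_kernel (s, y) * indicator X (s, y) \<partial>lborel) \<partial>S)"
    proof (rule nn_integral_cong)
      fix s
      show "(\<integral>\<^sup>+y. uniform_kernel (s, y) * indicator B y \<partial>lborel) * indicator C s =
          (\<integral>\<^sup>+y. uniform_kernel (s, y) * indicator X (s, y) \<partial>lborel)"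
        by (cases "s \<in> C") (simp_all add: X indicator_times)
    qed
    also have "\<dots> = (\<integral>\<^sup>+p. uniform_kernel p * indicator X p \<partial>(S \<Otimes>\<^sub>M lborel))"
      by (rule lborel.nn_integral_fst) measurable
    also have "\<dots> = emeasure (density (S \<Otimes>\<^sub>M lborel) uniform_kernel) X"
      by (rule emeasure_density[symmetric]) measurable
    finally show "emeasure D X = emeasure (density (S \<Otimes>\<^sub>M lborel) uniform_kernel) X" .
  qed simp_all
  then show ?thesis by (simp only: D_def S_def)
qed

text \<open>Transition formula of the endpoint chain, by Tonelli; the almost sure bounds and the
  expectations below rest on it.\<close>

lemma nn_integral_next_point:
  assumes [measurable]: "f \<in> borel_measurable ((borel \<Otimes>\<^sub>M borel) \<Otimes>\<^sub>M borel)"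
  shows "(\<integral>\<^sup>+\<omega>. f ((L n \<omega>, R n \<omega>), a (Suc n) \<omega>) \<partial>M) =
    (\<integral>\<^sup>+\<omega>. (\<integral>\<^sup>+y. uniform_kernel ((L n \<omega>, R n \<omega>), y) * f ((L n \<omega>, R n \<omega>), y) \<partial>lborel) \<partial>M)"
proof -
  let ?S = "distr M (borel \<Otimes>\<^sub>M borel) (\<lambda>\<omega>. (L n \<omega>, R n \<omega>))"
  have "(\<integral>\<^sup>+\<omega>. f ((L n \<omega>, R n \<omega>), a (Suc n) \<omega>) \<partial>M) =
      (\<integral>\<^sup>+p. f p \<partial>distr M ((borel \<Otimes>\<^sub>M borel) \<Otimes>\<^sub>M borel) (\<lambda>\<omega>. ((L n \<omega>, R n \<omega>), a (Suc n) \<omega>)))"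
    by (simp add: nn_integral_distr)
  also have "\<dots> = (\<integral>\<^sup>+p. uniform_kernel p * f p \<partial>(?S \<Otimes>\<^sub>M lborel))"
    unfolding distr_next_point by (rule nn_integral_density) measurable
  also have "\<dots> = (\<integral>\<^sup>+s. (\<integral>\<^sup>+y. uniform_kernel (s, y) * f (s, y) \<partial>lborel) \<partial>?S)"
    by (rule lborel.nn_integral_fst[symmetric]) measurable
  finally show ?thesis by (simp add: nn_integral_distr)
qed

section \<open>Almost sure bounds and one-step expectations\<close>

text \<open>The kernel vanishes outside the segment, so the transition formula gives the event of
  leaving it probability \<open>0\<close>.\<close>

lemma AE_next_point_in_segment:
  "AE \<omega> in M. L n \<omega> \<le> a (Suc n) \<omega> \<and> a (Suc n) \<omega> \<le> R n \<omega>"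
proof -
  let ?f = "\<lambda>p. if fst (fst p) \<le> snd p \<and> snd p \<le> snd (fst p) then 0 else 1 :: ennreal"
  have [measurable]: "?f \<in> borel_measurable ((borel \<Otimes>\<^sub>M borel :: (real \<times> real) measure) \<Otimes>\<^sub>M borel)"
    by measurable
  have "(\<integral>\<^sup>+\<omega>. ?f ((L n \<omega>, R n \<omega>), a (Suc n) \<omega>) \<partial>M) = 0"
    by (subst nn_integral_next_point) (auto simp: uniform_kernel_def if_distrib cong: if_cong)
  then have "AE \<omega> in M. ?f ((L n \<omega>, R n \<omega>), a (Suc n) \<omega>) = 0"
    by (subst (asm) nn_integral_0_iff_AE) measurable
  then show ?thesis by (rule eventually_mono) (auto split: if_splits)
qed

text \<open>If a segment has length at least \<open>1\<close>, cutting it at distance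
  \<open>1\<close> on both sides of one of its points leaves length at least
  \<open>1\<close>.\<close>

lemma AE_segment_length: "AE \<omega> in M. \<forall>n. 1 \<le> R n \<omega> - L n \<omega> \<and> R n \<omega> - L n \<omega> \<le> 2"
proof -
  have "AE \<omega> in M. \<forall>n. L n \<omega> \<le> a (Suc n) \<omega> \<and> a (Suc n) \<omega> \<le> R n \<omega>"
    using AE_next_point_in_segment by (simp add: AE_all_countable)
  then show ?thesis
  proof (rule eventually_mono, intro allI)
    fix \<omega> n assume *: "\<forall>n. L n \<omega> \<le> a (Suc n) \<omega> \<and> a (Suc n) \<omega> \<le> R n \<omega>"
    show "1 \<le> R n \<omega> - L n \<omega> \<and> R n \<omega> - L n \<omega> \<le> 2"
    proof (induction n)
      case (Suc n)
      then show ?case using spec[OF *, of n] by (auto simp: min_def max_def)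
    qed simp
  qed
qed

text \<open>Serves two uses: \<open>\<Phi> = \<Psi>\<close> for the harmonic function, and different
  functions for the gap. Nonnegativity permits working with \<open>nn_integral\<close>, where
  integrability is not at issue.\<close>

lemma expectation_step:
  fixes \<Phi> \<Psi> :: "real \<Rightarrow> real \<Rightarrow> real"
  assumes [measurable]: "case_prod \<Phi> \<in> borel_measurable (borel \<Otimes>\<^sub>M borel)"
      "case_prod \<Psi> \<in> borel_measurable (borel \<Otimes>\<^sub>M borel)"
    and nonneg: "\<And>l r. 0 \<le> \<Phi> l r" "\<And>l r. 0 \<le> \<Psi> l r"
    and average: "\<And>l r. 1 \<le> r - l \<Longrightarrow> r - l \<le> 2 \<Longrightarrow>
      ((\<lambda>y. \<Phi> (max l (y - 1)) (min r (y + 1))) has_integral (r - l) * \<Psi> l r) {l..r}"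
  shows "expectation (\<lambda>\<omega>. \<Phi> (L (Suc n) \<omega>) (R (Suc n) \<omega>)) = expectation (\<lambda>\<omega>. \<Psi> (L n \<omega>) (R n \<omega>))"
proof -
  let ?f = "\<lambda>p. ennreal (case_prod \<Phi> (max (fst (fst p)) (snd p - 1), min (snd (fst p)) (snd p + 1)))"
  have "(\<integral>\<^sup>+\<omega>. ennreal (\<Phi> (L (Suc n) \<omega>) (R (Suc n) \<omega>)) \<partial>M) =
      (\<integral>\<^sup>+\<omega>. ?f ((L n \<omega>, R n \<omega>), a (Suc n) \<omega>) \<partial>M)"
    by simp
  also have "\<dots> = (\<integral>\<^sup>+\<omega>. (\<integral>\<^sup>+y. uniform_kernel ((L n \<omega>, R n \<omega>), y) * ?f ((L n \<omega>, R n \<omega>), y) \<partial>lborel) \<partial>M)"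
    by (rule nn_integral_next_point) measurable
  also have "\<dots> = (\<integral>\<^sup>+\<omega>. ennreal (\<Psi> (L n \<omega>) (R n \<omega>)) \<partial>M)"
  proof (rule nn_integral_cong_AE, use AE_segment_length in \<open>rule eventually_mono\<close>)
    fix \<omega> assume *: "\<forall>n. 1 \<le> R n \<omega> - L n \<omega> \<and> R n \<omega> - L n \<omega> \<le> 2"
    define l r where "l = L n \<omega>" and "r = R n \<omega>"
    have lr: "1 \<le> r - l" "r - l \<le> 2" using * by (auto simp: l_def r_def)
    let ?g = "\<lambda>y. \<Phi> (max l (y - 1)) (min r (y + 1))"
    have "(\<integral>\<^sup>+y. ennreal (if y \<in> {l..r} then ?g y else 0) \<partial>lborel) = ennreal ((r - l) * \<Psi> l r)"
      using average[OF lr] nonneg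
      by (intro nn_integral_has_integral_lborel) (auto simp only: has_integral_restrict_UNIV, auto)
    moreover have "uniform_kernel ((l, r), y) * ?f ((l, r), y) =
        1 / ennreal (r - l) * ennreal (if y \<in> {l..r} then ?g y else 0)" for y
      by (auto simp: uniform_kernel_def)
    ultimately have "(\<integral>\<^sup>+y. uniform_kernel ((l, r), y) * ?f ((l, r), y) \<partial>lborel) =
        1 / ennreal (r - l) * ennreal ((r - l) * \<Psi> l r)"
      by (simp only: ) (subst nn_integral_cmult; simp)
    also have "\<dots> = ennreal (\<Psi> l r)"
      using lr nonneg divide_ennreal[of 1 "r - l"] by (simp add: ennreal_mult[symmetric])
    finally show "(\<integral>\<^sup>+y. uniform_kernel ((L n \<omega>, R n \<omega>), y) * ?f ((L n \<omega>, R n \<omega>), y) \<partial>lborel) =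
        ennreal (\<Psi> (L n \<omega>) (R n \<omega>))"
      by (simp add: l_def r_def)
  qed
  finally show ?thesis using nonneg by (simp add: integral_eq_nn_integral)
qed

lemma expectation_limit_cdf: "expectation (\<lambda>\<omega>. limit_cdf x (L n \<omega>) (R n \<omega>)) = limit_cdf x (-1) 1"
proof (induction n)
  case (Suc n)
  have "case_prod (limit_cdf x) \<in> borel_measurable (borel \<Otimes>\<^sub>M borel)"
    by measurable
  then have "expectation (\<lambda>\<omega>. limit_cdf x (L (Suc n) \<omega>) (R (Suc n) \<omega>)) =
      expectation (\<lambda>\<omega>. limit_cdf x (L n \<omega>) (R n \<omega>))"
    by (intro expectation_step limit_cdf_bounds limit_cdf_harmonic)
  with Suc show ?case by simp
qed (simp add: prob_space)

lemma expectation_gap: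
  "expectation (\<lambda>\<omega>. R (Suc n) \<omega> - L (Suc n) \<omega> - 1) =
   expectation (\<lambda>\<omega>. (R n \<omega> - L n \<omega> - 1) / (R n \<omega> - L n \<omega>))"
proof -
  \<comment> \<open>\<open>expectation_step\<close> asks for nonnegativity at all \<open>l\<close>
    and \<open>r\<close>, while the gap is nonnegative only almost surely; the absolute values
    bridge this and are removed afterwards.\<close>
  have "expectation (\<lambda>\<omega>. \<bar>R (Suc n) \<omega> - L (Suc n) \<omega> - 1\<bar>) =
      expectation (\<lambda>\<omega>. \<bar>(R n \<omega> - L n \<omega> - 1) / (R n \<omega> - L n \<omega>)\<bar>)"
  proof (rule expectation_step)
    fix l r :: real assume lr: "1 \<le> r - l" "r - l \<le> 2"
    have "((\<lambda>y. \<bar>min r (y + 1) - max l (y - 1) - 1\<bar>) has_integral (r - l - 1)) {l..r}"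
      by (rule has_integral_eq[OF _ gap_average[OF lr]]) (use lr in \<open>auto simp: min_def max_def\<close>)
    then show "((\<lambda>y. \<bar>min r (y + 1) - max l (y - 1) - 1\<bar>) has_integral
        (r - l) * \<bar>(r - l - 1) / (r - l)\<bar>) {l..r}"
      using lr by simp
  qed auto
  moreover have "expectation (\<lambda>\<omega>. \<bar>R (Suc n) \<omega> - L (Suc n) \<omega> - 1\<bar>) =
      expectation (\<lambda>\<omega>. R (Suc n) \<omega> - L (Suc n) \<omega> - 1)"
  proof (rule integral_cong_AE)
    show "AE \<omega> in M. \<bar>R (Suc n) \<omega> - L (Suc n) \<omega> - 1\<bar> = R (Suc n) \<omega> - L (Suc n) \<omega> - 1"
      using AE_segment_length by (rule eventually_mono) (metis abs_of_nonneg diff_ge_0_iff_ge)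
  qed measurable
  moreover have "expectation (\<lambda>\<omega>. \<bar>(R n \<omega> - L n \<omega> - 1) / (R n \<omega> - L n \<omega>)\<bar>) =
      expectation (\<lambda>\<omega>. (R n \<omega> - L n \<omega> - 1) / (R n \<omega> - L n \<omega>))"
  proof (rule integral_cong_AE)
    show "AE \<omega> in M. \<bar>(R n \<omega> - L n \<omega> - 1) / (R n \<omega> - L n \<omega>)\<bar> = (R n \<omega> - L n \<omega> - 1) / (R n \<omega> - L n \<omega>)"
      using AE_segment_length
    proof (rule eventually_mono)
      fix \<omega> assume "\<forall>n. 1 \<le> R n \<omega> - L n \<omega> \<and> R n \<omega> - L n \<omega> \<le> 2"
      then have "1 \<le> R n \<omega> - L n \<omega>" by blast
      then show "\<bar>(R n \<omega> - L n \<omega> - 1) / (R n \<omega> - L n \<omega>)\<bar> = (R n \<omega> - L n \<omega> - 1) / (R n \<omega> - L n \<omega>)"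
        by (intro abs_of_nonneg divide_nonneg_nonneg) auto
    qed
  qed measurable
  ultimately show ?thesis by simp
qed

section \<open>Convergence of the length and of the centre\<close>

text \<open>The lengths decrease to some \<open>G\<close>, and the limit of
  \<open>expectation_gap\<close> shows that \<open>G - 1\<close> and \<open>(G - 1) / G\<close> have
  equal mean. Their difference \<open>(G - 1)\<^sup>2 / G\<close> is nonnegative, hence zero almost
  surely.\<close>

lemma AE_length_tendsto: "AE \<omega> in M. (\<lambda>n. R n \<omega> - L n \<omega>) \<longlonglongrightarrow> 1"
proof -
  define G where "G \<omega> = lim (\<lambda>n. R n \<omega> - L n \<omega>)" for \<omega>
  have [measurable]: "G \<in> borel_measurable M"
    unfolding G_def by (rule borel_measurable_lim_metric) measurable
  have G: "AE \<omega> in M. (\<lambda>n. R n \<omega> - L n \<omega>) \<longlonglongrightarrow> G \<omega> \<and> 1 \<le> G \<omega> \<and> G \<omega> \<le> 2"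
    using AE_segment_length
  proof (rule eventually_mono)
    fix \<omega> assume *: "\<forall>n. 1 \<le> R n \<omega> - L n \<omega> \<and> R n \<omega> - L n \<omega> \<le> 2"
    have "decseq (\<lambda>n. R n \<omega> - L n \<omega>)"
      using incseqD[OF left_end_incseq[of "\<lambda>i. a i \<omega>"]] decseqD[OF right_end_decseq[of "\<lambda>i. a i \<omega>"]]
      by (auto simp: decseq_def intro!: diff_mono)
    then obtain g where "(\<lambda>n. R n \<omega> - L n \<omega>) \<longlonglongrightarrow> g"
      by (rule decseq_convergent[where B = 1]) (use * in auto)
    moreover from this have "1 \<le> g" "g \<le> 2"
      using * by (auto intro: LIMSEQ_le_const LIMSEQ_le_const2)
    ultimately show "(\<lambda>n. R n \<omega> - L n \<omega>) \<longlonglongrightarrow> G \<omega> \<and> 1 \<le> G \<omega> \<and> G \<omega> \<le> 2"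
      by (simp add: G_def limI)
  qed
  have lim1: "(\<lambda>n. expectation (\<lambda>\<omega>. R n \<omega> - L n \<omega> - 1)) \<longlonglongrightarrow> expectation (\<lambda>\<omega>. G \<omega> - 1)"
  proof (rule integral_dominated_convergence[where w = "\<lambda>_. 1"])
    show "AE \<omega> in M. (\<lambda>n. R n \<omega> - L n \<omega> - 1) \<longlonglongrightarrow> G \<omega> - 1"
      using G by eventually_elim (auto intro!: tendsto_intros)
    show "AE \<omega> in M. norm (R n \<omega> - L n \<omega> - 1) \<le> 1" for n
      using AE_segment_length by eventually_elim (auto simp: abs_le_iff)
  qed auto
  have lim2: "(\<lambda>n. expectation (\<lambda>\<omega>. (R n \<omega> - L n \<omega> - 1) / (R n \<omega> - L n \<omega>))) \<longlonglongrightarrow>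
      expectation (\<lambda>\<omega>. (G \<omega> - 1) / G \<omega>)"
  proof (rule integral_dominated_convergence[where w = "\<lambda>_. 1"])
    show "AE \<omega> in M. (\<lambda>n. (R n \<omega> - L n \<omega> - 1) / (R n \<omega> - L n \<omega>)) \<longlonglongrightarrow> (G \<omega> - 1) / G \<omega>"
      using G
    proof eventually_elim
      case (elim \<omega>)
      then show ?case by (intro tendsto_intros) auto
    qed
    show "AE \<omega> in M. norm ((R n \<omega> - L n \<omega> - 1) / (R n \<omega> - L n \<omega>)) \<le> 1" for n
      using AE_segment_length
    proof (rule eventually_mono)
      fix \<omega> assume "\<forall>n. 1 \<le> R n \<omega> - L n \<omega> \<and> R n \<omega> - L n \<omega> \<le> 2"
      then have "1 \<le> R n \<omega> - L n \<omega>" by blast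
      then show "norm ((R n \<omega> - L n \<omega> - 1) / (R n \<omega> - L n \<omega>)) \<le> 1"
        by (simp add: divide_simps)
    qed
  qed auto
  have "expectation (\<lambda>\<omega>. G \<omega> - 1) = expectation (\<lambda>\<omega>. (G \<omega> - 1) / G \<omega>)"
    using LIMSEQ_unique[OF LIMSEQ_Suc[OF lim1]] lim2 unfolding expectation_gap by blast
  moreover have int1: "integrable M (\<lambda>\<omega>. G \<omega> - 1)"
  proof (rule integrable_const_bound[where B = 1])
    show "AE \<omega> in M. norm (G \<omega> - 1) \<le> 1"
      using G by eventually_elim simp
  qed measurable
  moreover have int2: "integrable M (\<lambda>\<omega>. (G \<omega> - 1) / G \<omega>)"
  proof (rule integrable_const_bound[where B = 1])
    show "AE \<omega> in M. norm ((G \<omega> - 1) / G \<omega>) \<le> 1"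
      using G by eventually_elim (simp add: divide_simps)
  qed measurable
  ultimately have "expectation (\<lambda>\<omega>. (G \<omega> - 1) - (G \<omega> - 1) / G \<omega>) = 0"
    by simp
  moreover have "AE \<omega> in M. 0 \<le> (G \<omega> - 1) - (G \<omega> - 1) / G \<omega>"
    using G
  proof eventually_elim
    case (elim \<omega>)
    then have "(G \<omega> - 1) / G \<omega> \<le> (G \<omega> - 1) / 1" by (intro divide_left_mono) auto
    then show ?case by simp
  qed
  ultimately have "AE \<omega> in M. (G \<omega> - 1) - (G \<omega> - 1) / G \<omega> = 0"
    using int1 int2 by (subst (asm) integral_nonneg_eq_0_iff_AE) auto
  with G show ?thesis
  proof eventually_elim
    case (elim \<omega>)
    then have "(G \<omega> - 1) * (G \<omega> - 1) = 0" by (simp add: field_simps)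
    then have "G \<omega> = 1" by simp
    with elim show ?case by simp
  qed
qed

lemma Zn_eq: "Zn n \<omega> = centre {L n \<omega>..R n \<omega>}"
  by (simp add: Zn_def Xi_def segment_eq)

lemma measurable_Zn [measurable]: "Zn n \<in> borel_measurable M"
proof -
  \<comment> \<open>Measurability concerns every sample point, including those with an empty
    segment, where the centre is the fixed value \<open>centre {}\<close>.\<close>
  have "Zn n \<omega> = (if L n \<omega> \<le> R n \<omega> then (L n \<omega> + R n \<omega>) / 2 else centre {})" for \<omega>
    by (auto simp: Zn_eq centre_def cInf_atLeastAtMost cSup_atLeastAtMost)
  then have "Zn n = (\<lambda>\<omega>. if L n \<omega> \<le> R n \<omega> then (L n \<omega> + R n \<omega>) / 2 else centre {})"
    by (rule ext)
  then show ?thesis by simp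
qed

lemma measurable_Z [measurable]: "Z \<in> borel_measurable M"
  unfolding Z_def[abs_def] by (rule borel_measurable_lim_metric) measurable

text \<open>The left end increases to some \<open>l\<close>, so the right end decreases to
  \<open>l + 1\<close> and the centre tends to \<open>l + 1/2\<close>. Monotonicity gives the bounds
  for each \<open>n\<close>.\<close>

lemma AE_Z:
  "AE \<omega> in M. (\<lambda>n. Zn n \<omega>) \<longlonglongrightarrow> Z \<omega> \<and> (\<lambda>n. L n \<omega> + 1/2) \<longlonglongrightarrow> Z \<omega> \<and>
     (\<lambda>n. R n \<omega> - 1/2) \<longlonglongrightarrow> Z \<omega> \<and> (\<forall>n. L n \<omega> + 1/2 \<le> Z \<omega> \<and> Z \<omega> \<le> R n \<omega> - 1/2)"
  using AE_length_tendsto AE_segment_length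
proof eventually_elim
  case (elim \<omega>)
  obtain l where l: "L n \<omega> \<le> l" "(\<lambda>n. L n \<omega>) \<longlonglongrightarrow> l" for n
  proof (rule incseq_convergent[OF left_end_incseq[of "\<lambda>i. a i \<omega>"], of 1])
    show "\<forall>n. L n \<omega> \<le> 1"
      using elim(2) right_end_le[of "\<lambda>i. a i \<omega>"] by (meson diff_ge_0_iff_ge order.trans zero_le_one)
  qed auto
  have r: "(\<lambda>n. R n \<omega>) \<longlonglongrightarrow> l + 1"
    using tendsto_add[OF l(2) elim(1)] by simp
  have r': "l + 1 \<le> R n \<omega>" for n
    using decseq_ge[OF right_end_decseq r] .
  have "Zn n \<omega> = (L n \<omega> + R n \<omega>) / 2" for n
    using elim(2)[rule_format, of n]
    by (simp add: Zn_eq centre_def cInf_atLeastAtMost cSup_atLeastAtMost)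
  then have "(\<lambda>n. Zn n \<omega>) \<longlonglongrightarrow> (l + (l + 1)) / 2"
    by (simp only:) (intro tendsto_intros l r; simp)
  then have z: "(\<lambda>n. Zn n \<omega>) \<longlonglongrightarrow> l + 1/2" by (simp add: field_simps)
  then have Z: "Z \<omega> = l + 1/2" by (simp add: Z_def limI)
  have "(\<lambda>n. L n \<omega> + 1/2) \<longlonglongrightarrow> l + 1/2" "(\<lambda>n. R n \<omega> - 1/2) \<longlonglongrightarrow> l + 1 - 1/2"
    by (intro tendsto_intros l r)+
  with z l(1) r' show ?case unfolding Z by (auto simp: algebra_simps)
qed

section \<open>Squeezing the distribution function of the limit\<close>

text \<open>Where \<open>Z \<omega> < x\<close>, eventually \<open>R n \<omega> - 1/2 < x\<close>
  and the harmonic function is \<open>1\<close>, so its expectation restricted to this event tends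
  to the probability. The restricted expectation never exceeds the full one, which is independent of
  \<open>n\<close>.\<close>

lemma prob_Z_less: "prob {\<omega> \<in> space M. Z \<omega> < x} \<le> limit_cdf x (-1) 1"
proof -
  let ?H = "\<lambda>n \<omega>. limit_cdf x (L n \<omega>) (R n \<omega>)"
  let ?E = "{\<omega> \<in> space M. Z \<omega> < x}"
  have int: "integrable M (?H n)" for n
    by (rule integrable_const_bound[where B = 1]) (auto simp: limit_cdf_bounds)
  have "(\<lambda>n. expectation (\<lambda>\<omega>. indicator ?E \<omega> * ?H n \<omega>)) \<longlonglongrightarrow> expectation (indicator ?E)"
  proof (rule integral_dominated_convergence[where w = "\<lambda>_. 1"])
    show "AE \<omega> in M. (\<lambda>n. indicator ?E \<omega> * ?H n \<omega>) \<longlonglongrightarrow> indicator ?E \<omega>"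
      using AE_Z
    proof eventually_elim
      case (elim \<omega>)
      show ?case
      proof (cases "\<omega> \<in> ?E")
        case True
        then have "eventually (\<lambda>n. R n \<omega> - 1/2 < x) sequentially"
          using elim by (intro order_tendstoD(2)[of _ "Z \<omega>"]) auto
        then have "eventually (\<lambda>n. indicator ?E \<omega> * ?H n \<omega> = indicator ?E \<omega>) sequentially"
          by eventually_elim (simp add: limit_cdf_def)
        then show ?thesis by (rule tendsto_eventually)
      qed simp
    qed
    show "AE \<omega> in M. norm (indicator ?E \<omega> * ?H n \<omega>) \<le> 1" for n
      by (intro AE_I2) (auto simp: limit_cdf_bounds split: split_indicator)
  qed auto
  moreover have "expectation (\<lambda>\<omega>. indicator ?E \<omega> * ?H n \<omega>) \<le> limit_cdf x (-1) 1" for n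
    unfolding expectation_limit_cdf[of x n, symmetric]
    by (intro integral_mono int integrable_const_bound[where B = 1] AE_I2)
       (auto simp: limit_cdf_bounds split: split_indicator)
  ultimately show ?thesis
    by (intro LIMSEQ_le_const2[where X = "\<lambda>n. expectation (\<lambda>\<omega>. indicator ?E \<omega> * ?H n \<omega>)"])
       (auto simp: Int_absorb1)
qed

text \<open>Mirror image with one minus the harmonic function, which is \<open>1\<close> once
  \<open>x < L n \<omega> + 1/2\<close>.\<close>

lemma prob_Z_greater: "prob {\<omega> \<in> space M. x < Z \<omega>} \<le> 1 - limit_cdf x (-1) 1"
proof -
  let ?H = "\<lambda>n \<omega>. 1 - limit_cdf x (L n \<omega>) (R n \<omega>)"
  let ?E = "{\<omega> \<in> space M. x < Z \<omega>}"
  have int: "integrable M (\<lambda>\<omega>. limit_cdf x (L n \<omega>) (R n \<omega>))" for n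
    by (rule integrable_const_bound[where B = 1]) (auto simp: limit_cdf_bounds)
  have "(\<lambda>n. expectation (\<lambda>\<omega>. indicator ?E \<omega> * ?H n \<omega>)) \<longlonglongrightarrow> expectation (indicator ?E)"
  proof (rule integral_dominated_convergence[where w = "\<lambda>_. 1"])
    show "AE \<omega> in M. (\<lambda>n. indicator ?E \<omega> * ?H n \<omega>) \<longlonglongrightarrow> indicator ?E \<omega>"
      using AE_Z
    proof eventually_elim
      case (elim \<omega>)
      show ?case
      proof (cases "\<omega> \<in> ?E")
        case True
        then have "eventually (\<lambda>n. x < L n \<omega> + 1/2) sequentially"
          using elim by (intro order_tendstoD(1)[of _ "Z \<omega>"]) auto
        then have "eventually (\<lambda>n. indicator ?E \<omega> * ?H n \<omega> = indicator ?E \<omega>) sequentially"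
        proof eventually_elim
          case (elim n)
          \<comment> \<open>\<open>limit_cdf\<close> tests the right end first, so that branch has
            to be excluded by \<open>x < Z \<omega> \<le> R n \<omega> - 1/2\<close>.\<close>
          have "x < R n \<omega> - 1/2"
            using True \<open>_ \<and> _ \<and> _ \<and> (\<forall>n. _ n)\<close> by (auto intro: less_le_trans)
          with elim show ?case by (simp add: limit_cdf_def)
        qed
        then show ?thesis by (rule tendsto_eventually)
      qed simp
    qed
    show "AE \<omega> in M. norm (indicator ?E \<omega> * ?H n \<omega>) \<le> 1" for n
      by (intro AE_I2) (auto simp: limit_cdf_bounds split: split_indicator)
  qed auto
  moreover have "expectation (\<lambda>\<omega>. indicator ?E \<omega> * ?H n \<omega>) \<le> 1 - limit_cdf x (-1) 1" for n
  proof -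
    have "expectation (\<lambda>\<omega>. indicator ?E \<omega> * ?H n \<omega>) \<le> expectation (?H n)"
      by (intro integral_mono integrable_const_bound[where B = 1] AE_I2)
         (auto simp: limit_cdf_bounds split: split_indicator)
    also have "\<dots> = 1 - limit_cdf x (-1) 1"
      using int[of n] by (simp add: expectation_limit_cdf prob_space)
    finally show ?thesis .
  qed
  ultimately show ?thesis
    by (intro LIMSEQ_le_const2[where X = "\<lambda>n. expectation (\<lambda>\<omega>. indicator ?E \<omega> * ?H n \<omega>)"])
       (auto simp: Int_absorb1)
qed

lemma cdf_Z_lower: "limit_cdf x (-1) 1 \<le> cdf (distr M borel Z) x"
proof -
  have "cdf (distr M borel Z) x = prob {\<omega> \<in> space M. \<not> x < Z \<omega>}"
    unfolding cdf_def by (subst measure_distr) (auto intro!: arg_cong[where f = prob])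
  also have "\<dots> = 1 - prob {\<omega> \<in> space M. x < Z \<omega>}"
    by (rule prob_neg) measurable
  finally show ?thesis using prob_Z_greater[of x] by simp
qed

text \<open>Only strict events are bounded from above, so an atom at \<open>x\<close> is not
  excluded yet; the price is the larger argument \<open>y\<close>.\<close>

lemma cdf_Z_upper:
  assumes "x < y"
  shows "cdf (distr M borel Z) x \<le> limit_cdf y (-1) 1"
proof -
  have "cdf (distr M borel Z) x = prob {\<omega> \<in> space M. Z \<omega> \<le> x}"
    unfolding cdf_def by (subst measure_distr) (auto intro!: arg_cong[where f = prob])
  also have "\<dots> \<le> prob {\<omega> \<in> space M. Z \<omega> < y}"
    by (rule finite_measure_mono) (use assms in auto)
  finally show ?thesis using prob_Z_less[of y] by simp
qed

lemma limit_cdf_initial: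
  assumes "-1/2 \<le> x" "x \<le> 1/2"
  shows "limit_cdf x (-1) 1 = 2 / pi * arcsin (sqrt (x + 1/2))"
proof -
  consider "x = 1/2" | "x = -1/2" | "-1/2 < x" "x < 1/2" using assms by linarith
  then show ?thesis
  proof cases
    case 1
    show ?thesis unfolding 1 by (simp add: limit_cdf_def)
  qed (simp_all add: limit_cdf_def add.commute)
qed

lemma cdf_Z:
  assumes x: "-1/2 \<le> x" "x \<le> 1/2"
  shows "cdf (distr M borel Z) x = 2 / pi * arcsin (sqrt (x + 1/2))"
proof (rule antisym)
  show "2 / pi * arcsin (sqrt (x + 1/2)) \<le> cdf (distr M borel Z) x"
    using cdf_Z_lower[of x] limit_cdf_initial[OF x] by simp
  show "cdf (distr M borel Z) x \<le> 2 / pi * arcsin (sqrt (x + 1/2))"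
  proof (cases "x = 1/2")
    \<comment> \<open>No larger argument remains in the range of the formula, but the formula gives
      \<open>1\<close> here and total mass suffices.\<close>
    case True
    interpret D: prob_space "distr M borel Z" by (rule prob_space_distr) measurable
    show ?thesis using D.prob_le_1[of "{..1/2}"] unfolding True by (simp add: cdf_def)
  next
    case False
    \<comment> \<open>Decreases from \<open>1/2\<close> to \<open>x\<close> inside the range of
      \<open>limit_cdf_initial\<close>, so continuity of the arcsine expression closes the upper
      bound.\<close>
    define y where "y n = x + (1/2 - x) * inverse (real (Suc n))" for n
    have y: "x < y n" "y n \<le> 1/2" for n
      using False x mult_left_mono[of "inverse (real (Suc n))" 1 "1/2 - x"]
      by (auto simp: y_def field_simps)
    have lim: "y \<longlonglongrightarrow> x"
      unfolding y_def
      by (rule tendsto_eq_intros LIMSEQ_inverse_real_of_nat refl)+ simp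
    have "continuous_on {-1/2..1/2} (\<lambda>x::real. 2 / pi * arcsin (sqrt (x + 1/2)))"
      by (intro continuous_intros) (auto intro: order.trans[of _ 0])
    then have "(\<lambda>n. 2 / pi * arcsin (sqrt (y n + 1/2))) \<longlonglongrightarrow> 2 / pi * arcsin (sqrt (x + 1/2))"
      by (rule continuous_on_tendsto_compose[OF _ lim])
         (use x y(2) order.trans[OF x(1) less_imp_le[OF y(1)]] in \<open>auto intro!: always_eventually\<close>)
    moreover have "cdf (distr M borel Z) x \<le> 2 / pi * arcsin (sqrt (y n + 1/2))" for n
      using cdf_Z_upper[OF y(1)[of n]] limit_cdf_initial[of "y n"] y[of n] x by simp
    ultimately show ?thesis
      by (intro LIMSEQ_le_const[where X = "\<lambda>n. 2 / pi * arcsin (sqrt (y n + 1/2))"]) auto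
  qed
qed

end

theorem theorem2:
  fixes M :: "'a measure" and a :: "nat \<Rightarrow> 'a \<Rightarrow> real"
  assumes "diminishing_segment_process M a"
  shows "(AE \<omega> in M. convergent (\<lambda>n. diminishing_segment_process.Zn a n \<omega>)) \<and>
    (AE \<omega> in M. diminishing_segment_process.Z a \<omega> \<in> {-1/2..1/2}) \<and>
    (\<forall>x::real. -1/2 \<le> x \<and> x \<le> 1/2 \<longrightarrow>
      cdf (distr M borel (diminishing_segment_process.Z a)) x = 2 / pi * arcsin (sqrt (x + 1/2)))"
proof -
  interpret diminishing_segment_process M a by fact
  have "AE \<omega> in M. convergent (\<lambda>n. Zn n \<omega>)"
    using AE_Z by eventually_elim (auto simp: convergent_def)
  moreover have "AE \<omega> in M. Z \<omega> \<in> {-1/2..1/2}"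
    using AE_Z
  proof eventually_elim
    case (elim \<omega>)
    \<comment> \<open>Index \<open>0\<close> is the segment with ends \<open>-1\<close> and
      \<open>1\<close>.\<close>
    then have "L 0 \<omega> + 1/2 \<le> Z \<omega>" "Z \<omega> \<le> R 0 \<omega> - 1/2" by blast+
    then show ?case by simp
  qed
  ultimately show ?thesis using cdf_Z by blast
qed
end
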